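(* Let $n\ge 3$ be odd. On the space $\mathcal{T}$ of plane $n$-gons modulo parallel translations, with the symplectic form induced by $\omega$, the vector field $\xi$ is Hamiltonian with the perimeter $\mathcal{P}$ as its Hamiltonian function: $i_\xi\omega=d\mathcal{P}$.
   Context: A plane $n$-gon is an $n$-tuple $\mathbf{P}=(P_1,\dots,P_n)$ of points $P_i=(x_i,y_i)\in\mathbb{R}^2$ with $P_i\ne P_{i+1}$ for all $i$; indices are cyclic mod $n$. Let $a_i=|P_i-P_{i-1}|$ be the side lengths and $\mathcal{P}=\sum_{i=1}^n a_i$ the perimeter. The 2-form is $\omega=\sum_{1\le i<j\le n}(-1)^{i+j-1}(dx_i\wedge dx_j+dy_i\wedge dy_j)$; for odd $n$ its kernel is spanned by the diagonal parallel translations, so it induces a symplectic form on the quotient $\mathcal{T}$ by translations. The vector field is $$\xi=\sum_{i=1}^n\left(\frac{x_i-x_{i-1}}{a_i}+\frac{x_{i+1}-x_i}{a_{i+1}}\right)\partial_{x_i}+\left(\frac{y_i-y_{i-1}}{a_i}+\frac{y_{i+1}-y_i}{a_{i+1}}\right)\partial_{y_i},$$ which is translation invariant and descends to $\mathcal{T}$. The functions and forms above are likewise regarded on $\mathcal{T}$; $i_\xi\omega=\omega(\xi,\cdot)$. *)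

theory Defs
  imports "HOL-Analysis.Analysis"
begin

subsection \<open>Forms on open subsets of a finite-dimensional normed space\<close>

text \<open>A 2-form takes a base point and two tangent vectors. All tangent spaces of an open
  subset of a vector space are identified with that vector space.\<close>

type_synonym 'a two_form = "'a \<Rightarrow> 'a \<Rightarrow> 'a \<Rightarrow> real"

definition wedge :: "('a \<Rightarrow> real) \<Rightarrow> ('a \<Rightarrow> real) \<Rightarrow> 'a \<Rightarrow> 'a \<Rightarrow> real" where
  "wedge \<alpha> \<beta> u v = \<alpha> u * \<beta> v - \<beta> u * \<alpha> v"

definition interior_product :: "('a \<Rightarrow> 'a) \<Rightarrow> 'a two_form \<Rightarrow> 'a \<Rightarrow> 'a \<Rightarrow> real" where
  "interior_product X w p = w p (X p)"

text \<open>Only meant for open sets in finite dimension, where directional derivatives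
  determine the class.\<close>

primrec Ck_on :: "nat \<Rightarrow> 'a::real_normed_vector set \<Rightarrow> ('a \<Rightarrow> real) \<Rightarrow> bool" where
  "Ck_on 0 S f \<longleftrightarrow> continuous_on S f"
| "Ck_on (Suc k) S f \<longleftrightarrow> f differentiable_on S \<and>
     (\<forall>v. Ck_on k S (\<lambda>p. frechet_derivative f (at p) v))"

definition smooth_on :: "'a::real_normed_vector set \<Rightarrow> ('a \<Rightarrow> real) \<Rightarrow> bool" where
  "smooth_on S f \<longleftrightarrow> (\<forall>k. Ck_on k S f)"

definition ext_deriv :: "'a::real_normed_vector two_form \<Rightarrow> 'a \<Rightarrow> 'a \<Rightarrow> 'a \<Rightarrow> 'a \<Rightarrow> real" where
  "ext_deriv w p u v t =
     frechet_derivative (\<lambda>q. w q v t) (at p) u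
   - frechet_derivative (\<lambda>q. w q u t) (at p) v
   + frechet_derivative (\<lambda>q. w q u v) (at p) t"

definition symplectic_form_on :: "'a::real_normed_vector set \<Rightarrow> 'a two_form \<Rightarrow> bool" where
  "symplectic_form_on S w \<longleftrightarrow>
     open S \<and>
     (\<forall>p\<in>S. bounded_bilinear (w p)) \<and>
     (\<forall>p\<in>S. \<forall>u. w p u u = 0) \<and>
     (\<forall>u v. smooth_on S (\<lambda>p. w p u v)) \<and>
     (\<forall>p\<in>S. \<forall>u v t. ext_deriv w p u v t = 0) \<and>
     (\<forall>p\<in>S. \<forall>u. (\<forall>v. w p u v = 0) \<longrightarrow> u = 0)"

definition hamiltonian_on ::
  "'a::real_normed_vector set \<Rightarrow> 'a two_form \<Rightarrow> ('a \<Rightarrow> 'a) \<Rightarrow> ('a \<Rightarrow> real) \<Rightarrow> bool" where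
  "hamiltonian_on S w X H \<longleftrightarrow>
     (\<forall>p\<in>S. H differentiable (at p) \<and>
            interior_product X w p = frechet_derivative H (at p))"


subsection \<open>Plane polygons\<close>

text \<open>An $n$-tuple of points is a vector \<open>P :: real^2^'n\<close> with \<open>n = CARD('n)\<close>; the class
  \<open>enum\<close> supplies the order of the labels. \<open>vertex P i\<close> is $P_i$, with \<open>i\<close> read modulo \<open>n\<close>,
  so that \<open>P\<close> has the vertices \<open>vertex P 1, ..., vertex P n\<close> and \<open>vertex P 0 = vertex P n\<close>,
  \<open>vertex P (n + 1) = vertex P 1\<close>. The number \<open>idx k\<close> in \<open>{1..n}\<close> is the position of the
  label \<open>k\<close>.\<close>

definition vertex :: "'a^'n::enum \<Rightarrow> nat \<Rightarrow> 'a" where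
  "vertex P i = P $ (enum_class.enum ! ((i + CARD('n) - 1) mod CARD('n)))"

definition idx :: "'n::enum \<Rightarrow> nat" where
  "idx k = (THE i. i \<in> {1..CARD('n)} \<and> enum_class.enum ! (i - 1) = k)"

definition is_ngon :: "real^2^'n::enum \<Rightarrow> bool" where
  "is_ngon P \<longleftrightarrow> (\<forall>i\<in>{1..CARD('n)}. vertex P i \<noteq> vertex P (i + 1))"

definition side :: "real^2^'n::enum \<Rightarrow> nat \<Rightarrow> real" where
  "side P i = norm (vertex P i - vertex P (i - 1))"

definition perimeter :: "real^2^'n::enum \<Rightarrow> real" where
  "perimeter P = (\<Sum>i=1..CARD('n). side P i)"

definition dx :: "nat \<Rightarrow> real^2^'n::enum \<Rightarrow> real" where
  "dx i u = vertex u i $ 1"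

definition dy :: "nat \<Rightarrow> real^2^'n::enum \<Rightarrow> real" where
  "dy i u = vertex u i $ 2"

definition omega :: "(real^2^'n::enum) two_form" where
  "omega P u v = (\<Sum>i=1..CARD('n). \<Sum>j\<in>{i<..CARD('n)}.
     (-1) ^ (i + j - 1) * (wedge (dx i) (dx j) u v + wedge (dy i) (dy j) u v))"

definition xi :: "real^2^'n::enum \<Rightarrow> real^2^'n::enum" where
  "xi P = (\<chi> k. let i = idx k in
     (vertex P i - vertex P (i - 1)) /\<^sub>R side P i +
     (vertex P (i + 1) - vertex P i) /\<^sub>R side P (i + 1))"


subsection \<open>The quotient by parallel translations\<close>

definition translate_eq :: "real^2^'n::finite \<Rightarrow> real^2^'n \<Rightarrow> bool" where
  "translate_eq P Q \<longleftrightarrow> (\<exists>c. \<forall>k. Q $ k = P $ k + c)"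

lemma equivp_translate_eq: "equivp translate_eq"
proof (rule equivpI)
  show "reflp translate_eq"
    unfolding reflp_def translate_eq_def by (auto intro: exI[of _ 0])
  show "symp translate_eq"
  proof (rule sympI)
    fix P Q :: "real^2^'n" assume "translate_eq P Q"
    then obtain c where "\<forall>k. Q $ k = P $ k + c" unfolding translate_eq_def by blast
    then have "\<forall>k. P $ k = Q $ k + (- c)" by simp
    then show "translate_eq Q P" unfolding translate_eq_def by blast
  qed
  show "transp translate_eq"
  proof (rule transpI)
    fix P Q R :: "real^2^'n" assume "translate_eq P Q" "translate_eq Q R"
    then obtain c d where "\<forall>k. Q $ k = P $ k + c" "\<forall>k. R $ k = Q $ k + d"
      unfolding translate_eq_def by blast
    then have "\<forall>k. R $ k = P $ k + (c + d)" by (simp add: add.assoc)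
    then show "translate_eq P R" unfolding translate_eq_def by blast
  qed
qed

text \<open>The quotient of the vector space of all $n$-tuples by the diagonal translations; the
  space of $n$-gons modulo translations is the open subset \<open>ngon_space\<close> below.\<close>

quotient_type 'n tuple_mod = "real^2^'n::finite" / translate_eq
  by (rule equivp_translate_eq)

abbreviation proj :: "real^2^'n::finite \<Rightarrow> 'n tuple_mod" where
  "proj \<equiv> abs_tuple_mod"

instantiation tuple_mod :: (finite) real_vector
begin

lift_definition zero_tuple_mod :: "'a tuple_mod" is 0 .

lift_definition plus_tuple_mod :: "'a tuple_mod \<Rightarrow> 'a tuple_mod \<Rightarrow> 'a tuple_mod" is "(+)"
  proof -
  fix P Q P' Q' :: "real^2^'a" assume "translate_eq P Q" "translate_eq P' Q'"
  then obtain c d where "\<forall>k. Q $ k = P $ k + c" "\<forall>k. Q' $ k = P' $ k + d"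
    unfolding translate_eq_def by blast
  then have "\<forall>k. (Q + Q') $ k = (P + P') $ k + (c + d)" by simp
  then show "translate_eq (P + P') (Q + Q')" unfolding translate_eq_def by blast
qed

lift_definition uminus_tuple_mod :: "'a tuple_mod \<Rightarrow> 'a tuple_mod" is uminus
  proof -
  fix P Q :: "real^2^'a" assume "translate_eq P Q"
  then obtain c where "\<forall>k. Q $ k = P $ k + c" unfolding translate_eq_def by blast
  then have "\<forall>k. (- Q) $ k = (- P) $ k + (- c)" by simp
  then show "translate_eq (- P) (- Q)" unfolding translate_eq_def by blast
qed

lift_definition minus_tuple_mod :: "'a tuple_mod \<Rightarrow> 'a tuple_mod \<Rightarrow> 'a tuple_mod" is "(-)"
  proof -
  fix P Q P' Q' :: "real^2^'a" assume "translate_eq P Q" "translate_eq P' Q'"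
  then obtain c d where "\<forall>k. Q $ k = P $ k + c" "\<forall>k. Q' $ k = P' $ k + d"
    unfolding translate_eq_def by blast
  then have "\<forall>k. (Q - Q') $ k = (P - P') $ k + (c - d)" by simp
  then show "translate_eq (P - P') (Q - Q')" unfolding translate_eq_def by blast
qed

lift_definition scaleR_tuple_mod :: "real \<Rightarrow> 'a tuple_mod \<Rightarrow> 'a tuple_mod" is "scaleR"
  proof -
  fix r :: real and P Q :: "real^2^'a" assume "translate_eq P Q"
  then obtain c where "\<forall>k. Q $ k = P $ k + c" unfolding translate_eq_def by blast
  then have "\<forall>k. (r *\<^sub>R Q) $ k = (r *\<^sub>R P) $ k + r *\<^sub>R c"
    by (simp add: scaleR_add_right)
  then show "translate_eq (r *\<^sub>R P) (r *\<^sub>R Q)" unfolding translate_eq_def by blast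
qed

instance
proof
  have refl: "translate_eq P Q" if "P = Q" for P Q :: "real^2^'a"
    using that equivp_reflp[OF equivp_translate_eq] by simp
  fix a b c :: "'a tuple_mod" and r s :: real
  show "a + b + c = a + (b + c)" by transfer (rule refl, simp add: algebra_simps)
  show "a + b = b + a" by transfer (rule refl, simp add: algebra_simps)
  show "0 + a = a" by transfer (rule refl, simp)
  show "- a + a = 0" by transfer (rule refl, simp)
  show "a - b = a + - b" by transfer (rule refl, simp)
  show "r *\<^sub>R (a + b) = r *\<^sub>R a + r *\<^sub>R b" by transfer (rule refl, simp add: algebra_simps)
  show "(r + s) *\<^sub>R a = r *\<^sub>R a + s *\<^sub>R a" by transfer (rule refl, simp add: algebra_simps)
  show "r *\<^sub>R s *\<^sub>R a = (r * s) *\<^sub>R a" by transfer (rule refl, simp)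
  show "1 *\<^sub>R a = a" by transfer (rule refl, simp)
qed

end

text \<open>The representative with centroid 0. Its norm is the quotient norm, since centring is
  the orthogonal projection along the diagonal.\<close>

definition centred :: "real^2^'n::finite \<Rightarrow> real^2^'n" where
  "centred P = (\<chi> k. P $ k - (\<Sum>l\<in>UNIV. P $ l) /\<^sub>R real CARD('n))"

lemma centred_eq: "translate_eq (P :: real^2^'a) Q \<Longrightarrow> centred P = centred Q"
proof -
  assume "translate_eq P Q"
  then obtain c where c: "\<And>k. Q $ k = P $ k + c" unfolding translate_eq_def by blast
  have *: "(\<Sum>l\<in>UNIV. Q $ l) = (\<Sum>l\<in>UNIV. P $ l) + real CARD('a) *\<^sub>R c"
    by (simp only: c sum.distrib sum_constant_scaleR)
  have "(\<Sum>l\<in>UNIV. Q $ l) /\<^sub>R real CARD('a) = (\<Sum>l\<in>UNIV. P $ l) /\<^sub>R real CARD('a) + c"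
    unfolding * by (simp add: scaleR_add_right)
  then have "centred Q $ k = centred P $ k" for k
    by (simp only: centred_def vec_lambda_beta) (simp add: c)
  then show "centred P = centred Q" by (simp add: vec_eq_iff)
qed

lemma centred_add: "centred (P + Q) = centred P + centred Q"
  by (simp add: centred_def vec_eq_iff sum.distrib algebra_simps)

lemma centred_scaleR: "centred (r *\<^sub>R P) = r *\<^sub>R centred P"
  by (simp add: centred_def vec_eq_iff sum_distrib_left[symmetric] right_diff_distrib)

lemma translate_eq_centred: "translate_eq (centred P) (P :: real^2^'a)"
  unfolding translate_eq_def centred_def
  by (rule exI[of _ "(\<Sum>l\<in>UNIV. P $ l) /\<^sub>R real CARD('a)"]) simp

lemma centred_0_iff: "centred (P :: real^2^'a) = 0 \<longleftrightarrow> translate_eq P 0"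
proof
  assume "centred P = 0"
  then have "translate_eq 0 P" using translate_eq_centred[of P] by simp
  then show "translate_eq P 0" by (rule equivp_symp[OF equivp_translate_eq])
next
  assume "translate_eq P 0"
  then have "centred P = centred 0" by (rule centred_eq)
  also have "centred 0 = (0 :: real^2^'a)" by (simp add: centred_def vec_eq_iff)
  finally show "centred P = 0" .
qed

instantiation tuple_mod :: (finite) real_normed_vector
begin

lift_definition norm_tuple_mod :: "'a tuple_mod \<Rightarrow> real" is "\<lambda>P. norm (centred P)"
  by (simp add: centred_eq)

definition dist_tuple_mod :: "'a tuple_mod \<Rightarrow> 'a tuple_mod \<Rightarrow> real" where
  "dist_tuple_mod a b = norm (a - b)"

definition sgn_tuple_mod :: "'a tuple_mod \<Rightarrow> 'a tuple_mod" where
  "sgn_tuple_mod a = inverse (norm a) *\<^sub>R a"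

definition uniformity_tuple_mod :: "('a tuple_mod \<times> 'a tuple_mod) filter" where
  "uniformity_tuple_mod = (INF e\<in>{0<..}. principal {(a, b). dist a b < e})"

definition open_tuple_mod :: "'a tuple_mod set \<Rightarrow> bool" where
  "open_tuple_mod U \<longleftrightarrow> (\<forall>a\<in>U. eventually (\<lambda>(a', b). a' = a \<longrightarrow> b \<in> U) uniformity)"

instance
proof
  fix a b :: "'a tuple_mod" and r :: real
  show "norm a = 0 \<longleftrightarrow> a = 0" by transfer (simp add: centred_0_iff)
  show "norm (a + b) \<le> norm a + norm b"
    by transfer (simp add: centred_add norm_triangle_ineq)
  show "norm (r *\<^sub>R a) = \<bar>r\<bar> * norm a" by transfer (simp add: centred_scaleR)
qed (simp_all add: dist_tuple_mod_def sgn_tuple_mod_def uniformity_tuple_mod_def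
    open_tuple_mod_def)

end

definition ngon_space :: "('n::enum) tuple_mod set" where
  "ngon_space = proj ` {P. is_ngon P}"

lemma vertex_translate: "(\<And>k. Q $ k = P $ k + c) \<Longrightarrow> vertex Q i = vertex P i + c"
  by (simp add: vertex_def)

lift_definition perimeter_T :: "('n::enum) tuple_mod \<Rightarrow> real" is perimeter
proof -
  fix P Q :: "real^2^'n::enum" assume "translate_eq P Q"
  then obtain c where c: "\<And>k. Q $ k = P $ k + c" unfolding translate_eq_def by blast
  show "perimeter P = perimeter Q"
    by (simp add: perimeter_def side_def vertex_translate[OF c])
qed

lift_definition xi_T :: "('n::enum) tuple_mod \<Rightarrow> 'n tuple_mod" is xi
proof -
  fix P Q :: "real^2^'n::enum" assume "translate_eq P Q"
  then obtain c where c: "\<And>k. Q $ k = P $ k + c" unfolding translate_eq_def by blast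
  have "xi P = xi Q"
    by (simp add: xi_def side_def vertex_translate[OF c] Let_def)
  then show "translate_eq (xi P) (xi Q)"
    using equivp_reflp[OF equivp_translate_eq] by simp
qed

text \<open>The form on the quotient whose pullback along the (linear) projection is \<open>omega\<close>. It
  exists only when \<open>omega\<close> vanishes on diagonal translations, which needs \<open>n\<close> odd; it is
  unique because \<open>proj\<close> is onto.\<close>

definition omega_T :: "(('n::enum) tuple_mod) two_form" where
  "omega_T = (THE w. \<forall>P u v. w (proj P) (proj u) (proj v) = omega P u v)"

end

theory Submission
  imports Defs
begin

text \<open>Let \<open>U i = e i + e (i + 1)\<close> for an \<open>n\<close>-periodic sequence \<open>e\<close> with \<open>n\<close> odd. Alternating sums of
  \<open>U\<close> telescope, so that \<open>\<omega>(U, V)\<close> becomes \<open>\<Sum>j. e j \<bullet> (V j - V (j - 1))\<close>. For the unit side vectors \<open>e\<close>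
  this is \<open>i\<^sub>\<xi>\<omega> = d\<P>\<close>; for constant \<open>e\<close> it shows that translations lie in the kernel of \<open>\<omega>\<close>; and for
  \<open>e j = V j - V (j - 1)\<close> it is a sum of squares, so that the kernel contains nothing else.\<close>

subsection \<open>Alternating double sums\<close>

lemma alternating_telescope:
  fixes e :: "nat \<Rightarrow> 'a::real_vector"
  assumes "m \<le> k"
  shows "(\<Sum>i=m..<k. (-1) ^ i *\<^sub>R (e i + e (Suc i))) = (-1) ^ m *\<^sub>R e m - (-1) ^ k *\<^sub>R e k"
  using assms by (induction k rule: dec_induct) (simp_all add: algebra_simps)

lemma triangle_sum_swap:
  fixes g :: "nat \<Rightarrow> nat \<Rightarrow> 'a::comm_monoid_add"
  shows "(\<Sum>i=1..n. \<Sum>j\<in>{i<..n}. g i j) = (\<Sum>j=1..n. \<Sum>i=1..<j. g i j)"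
  unfolding sum.Sigma[OF finite_atLeastAtMost ballI[OF finite_greaterThanAtMost]]
    sum.Sigma[OF finite_atLeastAtMost ballI[OF finite_atLeastLessThan]]
  by (rule sum.reindex_bij_witness[of _ "\<lambda>(j, i). (i, j)" "\<lambda>(i, j). (j, i)"]) auto

text \<open>Separates the two indices in the sign, so that the inner sum can telescope;
  \<open>Suc 0\<close> matches the simp normal form of \<open>1\<close>.\<close>

lemma minus_one_power_pred_add:
  "Suc 0 \<le> i \<Longrightarrow> (-1::real) ^ (i + j - Suc 0) = - ((-1) ^ i * (-1) ^ j)"
  by (cases i) (simp_all add: power_add)

text \<open>Collect the coefficient of each \<open>V j\<close>: the indices before \<open>j\<close>
  and those after \<open>j\<close> both telescope and leave the same boundary term in
  \<open>e 1\<close>, which cancels in the difference. A cyclic summation by parts then moves the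
  difference from \<open>e\<close> to \<open>V\<close>.\<close>

lemma alternating_double_sum:
  fixes e U V :: "nat \<Rightarrow> 'a::real_inner"
  assumes n: "odd n" and per: "e (Suc n) = e 1" "V 0 = V n"
    and U: "\<And>i. i \<in> {1..n} \<Longrightarrow> U i = e i + e (Suc i)"
  shows "(\<Sum>i=1..n. \<Sum>j\<in>{i<..n}. (-1) ^ (i + j - 1) * (U i \<bullet> V j - U j \<bullet> V i)) =
    (\<Sum>j=1..n. e j \<bullet> (V j - V (j - 1)))"
proof -
  let ?s = "\<lambda>i. (-1::real) ^ i"
  have left: "(\<Sum>i=1..<j. ?s (i + j - 1) * (U i \<bullet> V j)) = (e j + ?s j *\<^sub>R e 1) \<bullet> V j"
    if "j \<in> {1..n}" for j
  proof -
    have "(\<Sum>i=1..<j. ?s (i + j - 1) * (U i \<bullet> V j)) =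
        - ?s j * ((\<Sum>i=1..<j. ?s i *\<^sub>R (e i + e (Suc i))) \<bullet> V j)"
      unfolding inner_sum_left sum_distrib_left
      using that by (intro sum.cong) (auto simp: U minus_one_power_pred_add algebra_simps)
    also have "\<dots> = (e j + ?s j *\<^sub>R e 1) \<bullet> V j"
      using that by (subst alternating_telescope) (auto simp: algebra_simps)
    finally show ?thesis .
  qed
  have right: "(\<Sum>i\<in>{j<..n}. ?s (j + i - 1) * (U i \<bullet> V j)) = (e (Suc j) + ?s j *\<^sub>R e 1) \<bullet> V j"
    if "j \<in> {1..n}" for j
  proof -
    have "(\<Sum>i\<in>{j<..n}. ?s (j + i - 1) * (U i \<bullet> V j)) =
        - ?s j * ((\<Sum>i=Suc j..<Suc n. ?s i *\<^sub>R (e i + e (Suc i))) \<bullet> V j)"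
      unfolding inner_sum_left sum_distrib_left
      using that by (intro sum.cong) (auto simp: U minus_one_power_pred_add algebra_simps)
    \<comment> \<open>The upper end of the telescope is \<open>e (Suc n) = e 1\<close>, with sign
      (-1)^(n+1), which is 1 because \<open>n\<close> is odd.\<close>
    also have "\<dots> = (e (Suc j) + ?s j *\<^sub>R e 1) \<bullet> V j"
      using that n per by (subst alternating_telescope) (auto simp: algebra_simps)
    finally show ?thesis .
  qed
  \<comment> \<open>Exchanging the order of summation in the first half makes the argument of
    \<open>V\<close> the outer index in both halves.\<close>
  have "(\<Sum>i=1..n. \<Sum>j\<in>{i<..n}. ?s (i + j - 1) * (U i \<bullet> V j - U j \<bullet> V i)) =
      (\<Sum>j=1..n. \<Sum>i=1..<j. ?s (i + j - 1) * (U i \<bullet> V j)) -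
      (\<Sum>i=1..n. \<Sum>j\<in>{i<..n}. ?s (i + j - 1) * (U j \<bullet> V i))"
    unfolding triangle_sum_swap[symmetric] by (simp add: right_diff_distrib sum_subtractf)
  also have "\<dots> = (\<Sum>j=1..n. e j \<bullet> V j) - (\<Sum>j=1..n. e (Suc j) \<bullet> V j)"
    unfolding sum_subtractf[symmetric]
    by (intro sum.cong refl) (simp only: left right inner_add_left add_diff_cancel_right)
  also have "(\<Sum>j=1..n. e (Suc j) \<bullet> V j) = (\<Sum>j=Suc 1..Suc n. e j \<bullet> V (j - 1))"
    by (subst sum.shift_bounds_cl_Suc_ivl) simp
  \<comment> \<open>Periodicity turns the last term \<open>e (Suc n) \<bullet> V n\<close> into the
    missing first term \<open>e 1 \<bullet> V 0\<close>.\<close>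
  also have "\<dots> = (\<Sum>j=1..n. e j \<bullet> V (j - 1))"
  proof -
    have "1 \<le> n" using n by (simp add: odd_pos Suc_leI)
    then show ?thesis
      using sum.atLeast_Suc_atMost[of 1 n "\<lambda>j. e j \<bullet> V (j - 1)"] by (simp add: per add.commute)
  qed
  finally show ?thesis
    by (simp add: inner_diff_right sum_subtractf)
qed

subsection \<open>Vertices\<close>

lemma length_enum: "length (enum_class.enum :: 'n::enum list) = CARD('n)"
  by (metis UNIV_enum enum_distinct distinct_card)

lemma idx_enum_nth:
  assumes "i \<in> {1..CARD('n::enum)}"
  shows "idx (enum_class.enum ! (i - 1) :: 'n) = i"
  unfolding idx_def
proof (rule the_equality)
  fix j assume j: "j \<in> {1..CARD('n)} \<and> enum_class.enum ! (j - 1) = (enum_class.enum ! (i - 1) :: 'n)"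
  have "j - 1 = i - 1"
    by (rule nth_eq_iff_index_eq[OF enum_distinct[where 'a='n], THEN iffD1])
      (use j assms in \<open>auto simp: length_enum\<close>)
  with j assms show "j = i" by auto
qed (use assms in auto)

lemma vertex_eq:
  fixes P :: "'a^'n::enum"
  assumes "i \<in> {1..CARD('n)}"
  shows "vertex P i = P $ (enum_class.enum ! (i - 1))"
proof -
  have "(i + CARD('n) - 1) mod CARD('n) = (i - 1 + CARD('n)) mod CARD('n)"
    using assms by simp
  also have "\<dots> = i - 1"
    using assms by (subst mod_add_self2) (auto intro!: mod_less)
  finally show ?thesis
    by (simp add: vertex_def)
qed

lemma obtain_position:
  fixes k :: "'n::enum"
  obtains i where "i \<in> {1..CARD('n)}" "\<And>P :: 'a^'n::enum. P $ k = vertex P i"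
proof -
  have "k \<in> set enum_class.enum" by (simp add: enum_UNIV)
  then obtain m where m: "m < CARD('n)" "enum_class.enum ! m = k"
    by (auto simp: in_set_conv_nth length_enum)
  show ?thesis
    by (rule that[of "Suc m"]) (use m in \<open>auto simp: vertex_eq\<close>)
qed

text \<open>\<open>idx\<close> inverts the enumeration, so formulas given label by label, as for
  \<open>xi\<close>, can be read off at positions.\<close>

lemma vertex_vec_idx:
  "i \<in> {1..CARD('n::enum)} \<Longrightarrow> vertex (\<chi> k::'n. f (idx k)) i = f i"
  using idx_enum_nth[of i, where 'n='n] by (simp add: vertex_eq)

lemma vertex_0: "vertex (P :: 'a^'n::enum) 0 = vertex P CARD('n)"
  by (subst vertex_eq) (auto simp: vertex_def Suc_leI)

lemma vertex_Suc_card: "vertex (P :: 'a^'n::enum) (Suc CARD('n)) = vertex P 1"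
  by (simp add: vertex_def)

lemma linear_vertex: "linear (\<lambda>P :: 'a::real_vector^'n::enum. vertex P i)"
  by (intro linearI) (simp_all add: vertex_def)

lemmas vertex_linear_simps =
  linear_add[OF linear_vertex] linear_diff[OF linear_vertex] linear_scale[OF linear_vertex]

lemma bounded_linear_vertex: "bounded_linear (\<lambda>P :: real^2^'n::enum. vertex P i)"
  by (simp add: linear_conv_bounded_linear[symmetric] linear_vertex)

subsection \<open>The form on tuples\<close>

text \<open>The x and y parts combine to inner products in the plane, the shape that
  \<open>alternating_double_sum\<close> expects.\<close>

lemma omega_inner:
  "omega P u v = (\<Sum>i=1..CARD('n). \<Sum>j\<in>{i<..CARD('n)}. (-1) ^ (i + j - 1) *
     (vertex u i \<bullet> vertex v j - vertex u j \<bullet> vertex v i))"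
  for u v :: "real^2^'n::enum"
  unfolding omega_def wedge_def dx_def dy_def
  by (simp add: inner_vec_def sum_2 algebra_simps)

text \<open>Constant coefficients: on the quotient this makes smoothness and closedness
  immediate.\<close>

lemma omega_base_point: "omega P = omega Q"
  by (simp add: omega_def fun_eq_iff)

lemma omega_antisym: "omega P u v = - omega P v u"
  unfolding omega_inner sum_negf[symmetric]
  by (intro sum.cong refl) (simp add: inner_commute algebra_simps)

lemma bilinear_omega: "bilinear (omega P)"
proof -
  have "linear (omega P u)" for u
  proof (rule linearI)
    show "omega P u (v + w) = omega P u v + omega P u w" for v w
      unfolding omega_inner sum.distrib[symmetric]
      by (intro sum.cong refl) (simp add: vertex_linear_simps inner_add_left inner_add_right ring_distribs)
    show "omega P u (r *\<^sub>R v) = r *\<^sub>R omega P u v" for r v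
      unfolding omega_inner real_scaleR_def sum_distrib_left
      by (intro sum.cong refl) (simp add: vertex_linear_simps right_diff_distrib mult.left_commute)
  qed
  moreover from this have "linear (\<lambda>u. omega P u v)" for v
    unfolding omega_antisym[of P _ v] by (rule linear_compose_neg)
  ultimately show ?thesis by (simp add: bilinear_def)
qed

lemma omega_consecutive_sums:
  fixes u v :: "real^2^'n::enum"
  assumes "odd CARD('n)" "e (Suc CARD('n)) = e 1"
    and "\<And>i. i \<in> {1..CARD('n)} \<Longrightarrow> vertex u i = e i + e (Suc i)"
  shows "omega P u v = (\<Sum>j=1..CARD('n). e j \<bullet> (vertex v j - vertex v (j - 1)))"
  unfolding omega_inner using assms by (intro alternating_double_sum vertex_0)

lemma omega_translation_left:
  fixes u v :: "real^2^'n::enum"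
  assumes n: "odd CARD('n)" and u: "translate_eq u 0"
  shows "omega P u v = 0"
proof -
  obtain c where c: "\<And>k. 0 = u $ k + c"
    using u by (auto simp: translate_eq_def)
  have "vertex u i = - c" for i
    using c by (simp add: vertex_def eq_neg_iff_add_eq_0)
  \<comment> \<open>The constant \<open>- c\<close> is twice its half, so a constant
    \<open>e\<close> serves, and the resulting sum telescopes around the closed polygon to
    zero.\<close>
  then have "omega P u v =
      (\<Sum>j=1..CARD('n). (- c /\<^sub>R 2) \<bullet> (vertex v j - vertex v (j - 1)))"
    using n by (intro omega_consecutive_sums) (auto simp: scaleR_add_left[symmetric])
  also have "\<dots> = (- c /\<^sub>R 2) \<bullet> (vertex v CARD('n) - vertex v 0)"
    unfolding inner_sum_right[symmetric]
    using sum_telescope''[of 0 "CARD('n)" "vertex v"] by simp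
  finally show ?thesis by (simp add: vertex_0)
qed

lemma omega_translate_eq:
  fixes u v u' v' :: "real^2^'n::enum"
  assumes n: "odd CARD('n)" and "translate_eq u u'" "translate_eq v v'"
  shows "omega P u v = omega P u' v'"
proof -
  have left: "omega P u v = omega P u' v" if "translate_eq u u'" for u u' v :: "real^2^'n::enum"
  proof -
    have "translate_eq (u - u') 0"
      using that by (auto simp: translate_eq_def algebra_simps)
    then have "omega P (u - u') v = 0" by (rule omega_translation_left[OF n])
    then show ?thesis by (simp add: bilinear_lsub[OF bilinear_omega])
  qed
  have "omega P u v = omega P u' v" using assms by (intro left)
  also have "\<dots> = omega P u' v'"
    unfolding omega_antisym[of P u'] using assms by (simp only: left)
  finally show ?thesis .
qed

lemma omega_kernel:
  fixes u :: "real^2^'n::enum"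
  assumes n: "odd CARD('n)" and zero: "\<And>v. omega P u v = 0"
  shows "translate_eq u 0"
proof -
  define e where "e i = vertex u i - vertex u (i - 1)" for i
  \<comment> \<open>The test vector is built from the sides of \<open>u\<close> itself, so that its
    pairing with \<open>u\<close> is the sum of their squared lengths.\<close>
  define w where "w = (\<chi> k::'n. e (idx k) + e (Suc (idx k)))"
  have "vertex w i = e i + e (Suc i)" if "i \<in> {1..CARD('n)}" for i
    unfolding w_def using that by (rule vertex_vec_idx)
  then have "omega P w u = (\<Sum>j=1..CARD('n). e j \<bullet> (vertex u j - vertex u (j - 1)))"
    by (intro omega_consecutive_sums n) (simp_all add: e_def vertex_0 vertex_Suc_card)
  then have "omega P w u = (\<Sum>j=1..CARD('n). e j \<bullet> e j)"
    by (simp add: e_def)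
  moreover have "omega P w u = 0"
    by (subst omega_antisym) (simp add: zero)
  ultimately have e0: "e j = 0" if "j \<in> {1..CARD('n)}" for j
    using that by (simp add: sum_nonneg_eq_0_iff)
  have const: "i \<le> CARD('n) \<Longrightarrow> vertex u i = vertex u 0" for i
  proof (induction i)
    case (Suc i)
    then show ?case using e0[of "Suc i"] by (simp add: e_def)
  qed simp
  have "0 = u $ k + - vertex u 0" for k
  proof -
    obtain i where "i \<in> {1..CARD('n)}" "u $ k = vertex u i"
      by (metis obtain_position)
    then show ?thesis using const[of i] by simp
  qed
  then show ?thesis
    unfolding translate_eq_def by (intro exI[of _ "- vertex u 0"]) simp
qed

subsection \<open>The perimeter\<close>

lemma is_ngon_side:
  fixes P :: "real^2^'n::enum"
  assumes "is_ngon P" "i \<in> {1..CARD('n)}"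
  shows "vertex P (i - 1) \<noteq> vertex P i"
proof (cases "i = 1")
  case True
  \<comment> \<open>\<open>is_ngon\<close> compares each vertex with its successor, so the side from
    \<open>vertex P 0\<close> to \<open>vertex P 1\<close> is covered by its condition at the last
    index.\<close>
  have "CARD('n) \<in> {1..CARD('n)}" by (simp add: Suc_leI)
  then have "vertex P CARD('n) \<noteq> vertex P (CARD('n) + 1)"
    using assms(1) unfolding is_ngon_def by blast
  with True show ?thesis by (simp add: vertex_0 vertex_Suc_card)
next
  case False
  with assms(2) have "i - 1 \<in> {1..CARD('n)}" "i - 1 + 1 = i" by auto
  with assms(1) show ?thesis unfolding is_ngon_def by metis
qed

lemma open_ngons: "open {P :: real^2^'n::enum. is_ngon P}"
proof -
  have "{P :: real^2^'n::enum. is_ngon P} =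
      (\<Inter>i\<in>{1..CARD('n)}. {P. vertex P i \<noteq> vertex P (i + 1)})"
    by (auto simp: is_ngon_def)
  then show ?thesis
    by (auto intro!: open_INT open_Collect_neq linear_continuous_on bounded_linear_vertex)
qed

lemma xi_omega:
  fixes P v :: "real^2^'n::enum"
  assumes "odd CARD('n)"
  shows "omega P (xi P) v = (\<Sum>j=1..CARD('n).
    (vertex P j - vertex P (j - 1)) \<bullet> (vertex v j - vertex v (j - 1)) / side P j)"
proof -
  \<comment> \<open>The unit side vectors; at each vertex \<open>xi\<close> is the sum of the two
    adjacent ones.\<close>
  define e where "e i = (vertex P i - vertex P (i - 1)) /\<^sub>R side P i" for i
  have "vertex (xi P) i = e i + e (Suc i)" if "i \<in> {1..CARD('n)}" for i
    unfolding xi_def Let_def e_def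
    by (subst vertex_vec_idx[OF that]) simp
  then have "omega P (xi P) v = (\<Sum>j=1..CARD('n). e j \<bullet> (vertex v j - vertex v (j - 1)))"
    by (intro omega_consecutive_sums assms)
      (auto simp: e_def side_def vertex_0 vertex_Suc_card)
  then show ?thesis
    by (simp add: e_def divide_inverse mult.commute)
qed

text \<open>Each side vector is linear in the polygon and nonzero on an n-gon, where the derivative
  of the norm is the inner product with the unit vector. The result is written as in
  \<open>xi_omega\<close>, so that the two can be compared.\<close>

lemma has_derivative_perimeter:
  fixes P :: "real^2^'n::enum"
  assumes "is_ngon P"
  shows "(perimeter has_derivative (\<lambda>v. \<Sum>j=1..CARD('n).
    (vertex P j - vertex P (j - 1)) \<bullet> (vertex v j - vertex v (j - 1)) / side P j)) (at P)"
  unfolding perimeter_def[abs_def]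
proof (rule has_derivative_sum)
  fix j assume "j \<in> {1..CARD('n)}"
  then have ne: "vertex P j - vertex P (j - 1) \<noteq> 0"
    using is_ngon_side[OF assms] by fastforce
  have lin: "((\<lambda>P. vertex P j - vertex P (j - 1)) has_derivative
      (\<lambda>v. vertex v j - vertex v (j - 1))) (at P)"
    by (intro bounded_linear_imp_has_derivative bounded_linear_sub bounded_linear_vertex)
  show "((\<lambda>P. side P j) has_derivative
      (\<lambda>v. (vertex P j - vertex P (j - 1)) \<bullet> (vertex v j - vertex v (j - 1)) / side P j)) (at P)"
    unfolding side_def
    using has_derivative_compose[OF lin has_derivative_norm[OF ne]]
    by (simp add: sgn_div_norm inner_commute divide_inverse mult.commute)
qed

subsection \<open>Passing to the quotient\<close>

text \<open>A linear isometric section of \<open>proj\<close>: openness, bilinearity and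
  differentiability on the quotient are obtained by composing with it.\<close>

lift_definition centred_T :: "'n::finite tuple_mod \<Rightarrow> real^2^'n::finite" is centred
  by (rule centred_eq)

lemma proj_centred_T: "proj (centred_T a) = a"
  by transfer (rule translate_eq_centred)

lemma translate_eq_centred_T: "translate_eq (centred_T (proj P)) P"
  by transfer (rule translate_eq_centred)

lemma bounded_linear_centred_T: "bounded_linear centred_T"
proof (rule bounded_linear_intro)
  show "centred_T (a + b) = centred_T a + centred_T b" for a b :: "'a tuple_mod"
    by transfer (rule centred_add)
  show "centred_T (r *\<^sub>R a) = r *\<^sub>R centred_T a" for r and a :: "'a tuple_mod"
    by transfer (rule centred_scaleR)
  show "norm (centred_T a) \<le> norm a * 1" for a :: "'a tuple_mod"
    by transfer simp
qed

lemma is_ngon_translate_eq: "translate_eq P Q \<Longrightarrow> is_ngon P \<longleftrightarrow> is_ngon Q"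
  by (auto simp: translate_eq_def is_ngon_def vertex_translate)

text \<open>Turns an image under \<open>proj\<close> into a preimage under the continuous
  \<open>centred_T\<close>, from which openness follows.\<close>

lemma ngon_space_iff: "a \<in> ngon_space \<longleftrightarrow> is_ngon (centred_T a)"
proof
  assume "a \<in> ngon_space"
  then obtain P where "a = proj P" "is_ngon P" by (auto simp: ngon_space_def)
  then show "is_ngon (centred_T a)"
    using is_ngon_translate_eq[OF translate_eq_centred_T[of P]] by simp
next
  assume "is_ngon (centred_T a)"
  then show "a \<in> ngon_space"
    unfolding ngon_space_def by (metis imageI mem_Collect_eq proj_centred_T)
qed

lemma open_ngon_space: "open (ngon_space :: 'n::enum tuple_mod set)"
proof -
  have *: "ngon_space = centred_T -` {P. is_ngon (P :: real^2^'n::enum)}"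
    by (auto simp: ngon_space_iff)
  show ?thesis
    unfolding *
    by (intro open_vimage open_ngons linear_continuous_on bounded_linear_centred_T)
qed

text \<open>Resolves the definite description. Existence is translation invariance, where odd n
  enters; uniqueness holds since every class is \<open>proj\<close> of its centred representative.
  The base point \<open>0\<close> is an arbitrary choice.\<close>

lemma omega_T_eq:
  assumes n: "odd CARD('n::enum)"
  shows "omega_T = (\<lambda>a b c :: 'n tuple_mod. omega 0 (centred_T b) (centred_T c))"
  unfolding omega_T_def
proof (rule the_equality)
  show "\<forall>P u v :: real^2^'n::enum. omega 0 (centred_T (proj u)) (centred_T (proj v)) = omega P u v"
    using omega_translate_eq[OF n translate_eq_centred_T translate_eq_centred_T] omega_base_point
    by metis
next
  fix w :: "'n tuple_mod two_form"
  assume w: "\<forall>P u v. w (proj P) (proj u) (proj v) = omega P u v"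
  show "w = (\<lambda>a b c. omega 0 (centred_T b) (centred_T c))"
  proof (intro ext)
    show "w a b c = omega 0 (centred_T b) (centred_T c)" for a b c
      using w[rule_format, of "centred_T a" "centred_T b" "centred_T c"]
        omega_base_point[of "centred_T a" 0]
      by (simp add: proj_centred_T)
  qed
qed

lemma omega_T_proj:
  fixes P u v :: "real^2^'n::enum"
  assumes "odd CARD('n)"
  shows "omega_T (proj P) (proj u) (proj v) = omega P u v"
  unfolding omega_T_eq[OF assms] omega_base_point[of P 0]
  by (rule omega_translate_eq[OF assms translate_eq_centred_T translate_eq_centred_T])

lemma smooth_on_const: "smooth_on S (\<lambda>_. c)"
proof -
  have "Ck_on k S (\<lambda>_. c)" for k and c :: real
    \<comment> \<open>\<open>c\<close> is generalised because a directional derivative is another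
      constant, 0.\<close>
    by (induction k arbitrary: c) (simp_all add: frechet_derivative_const)
  then show ?thesis by (simp add: smooth_on_def)
qed

lemma symplectic_omega_T:
  assumes n: "odd CARD('n::enum)"
  shows "symplectic_form_on (ngon_space :: 'n tuple_mod set) omega_T"
  unfolding symplectic_form_on_def
proof (intro conjI ballI allI impI)
  show "open (ngon_space :: 'n tuple_mod set)" by (rule open_ngon_space)
next
  fix p :: "'n tuple_mod"
  have "bounded_bilinear (omega (0 :: real^2^'n::enum))"
    by (simp add: bilinear_conv_bounded_bilinear[symmetric] bilinear_omega)
  then show "bounded_bilinear (omega_T p)"
    unfolding omega_T_eq[OF n]
    by (rule bounded_bilinear.comp[OF _ bounded_linear_centred_T bounded_linear_centred_T])
next
  fix p u :: "'n tuple_mod"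
  show "omega_T p u u = 0"
    using omega_antisym[of 0 "centred_T u" "centred_T u"] by (simp add: omega_T_eq[OF n])
next
  fix u v :: "'n tuple_mod"
  show "smooth_on ngon_space (\<lambda>p. omega_T p u v)"
    by (simp add: omega_T_eq[OF n] smooth_on_const)
next
  fix p u v t :: "'n tuple_mod"
  show "ext_deriv omega_T p u v t = 0"
    by (simp add: ext_deriv_def omega_T_eq[OF n] frechet_derivative_const)
next
  fix p u :: "'n tuple_mod"
  assume zero: "\<forall>v. omega_T p u v = 0"
  \<comment> \<open>Testing against the classes \<open>proj v\<close> lifts the hypothesis to all
    tuples \<open>v\<close>, so that \<open>omega_kernel\<close> applies.\<close>
  have "omega 0 (centred_T u) v = 0" for v
    using zero omega_T_proj[OF n, of 0 "centred_T u" v]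
    by (simp add: omega_T_eq[OF n] proj_centred_T)
  then have "translate_eq (centred_T u) 0" by (rule omega_kernel[OF n])
  then have "proj (centred_T u) = proj 0" by (simp add: tuple_mod.abs_eq_iff)
  then show "u = 0" by (simp add: proj_centred_T zero_tuple_mod_def)
qed

lemma hamiltonian_xi_T:
  assumes n: "odd CARD('n::enum)"
  shows "hamiltonian_on (ngon_space :: 'n tuple_mod set) omega_T xi_T perimeter_T"
  unfolding hamiltonian_on_def
proof (intro ballI)
  fix p :: "'n tuple_mod"
  assume "p \<in> ngon_space"
  define P where "P = centred_T p"
  have p: "p = proj P" by (simp add: P_def proj_centred_T)
  have per: "perimeter_T = (\<lambda>a :: 'n tuple_mod. perimeter (centred_T a))"
    by (rule ext) (metis perimeter_T.abs_eq proj_centred_T)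
  have "is_ngon P"
    using \<open>p \<in> ngon_space\<close> by (simp add: P_def ngon_space_iff)
  \<comment> \<open>The two explicit formulas coincide: this is the Hamiltonian equation before
    passing to the quotient.\<close>
  then have "(perimeter has_derivative omega P (xi P)) (at P)"
    using has_derivative_perimeter xi_omega[OF n, abs_def] by (metis (no_types, lifting) ext)
  then have "(perimeter_T has_derivative (\<lambda>v. omega P (xi P) (centred_T v))) (at p)"
    unfolding per P_def
    by (intro has_derivative_compose[OF bounded_linear_imp_has_derivative[OF bounded_linear_centred_T]])
  \<comment> \<open>\<open>v\<close> is the class of \<open>centred_T v\<close>, so
    \<open>omega_T\<close> can be evaluated on representatives.\<close>
  moreover have "omega P (xi P) (centred_T v) = interior_product xi_T omega_T p v" for v
    using omega_T_proj[OF n, of P "xi P" "centred_T v"]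
    by (simp add: interior_product_def p xi_T.abs_eq proj_centred_T)
  ultimately have "(perimeter_T has_derivative interior_product xi_T omega_T p) (at p)"
    by simp
  then show "perimeter_T differentiable at p \<and>
      interior_product xi_T omega_T p = frechet_derivative perimeter_T (at p)"
    using differentiableI frechet_derivative_at by blast
qed

theorem lemma3p2:
  assumes "odd CARD('n::enum)" and "CARD('n) \<ge> 3"
  shows "(\<forall>(P :: real^2^'n::enum) u v. omega_T (proj P) (proj u) (proj v) = omega P u v) \<and>
         symplectic_form_on (ngon_space :: 'n tuple_mod set) omega_T \<and>
         hamiltonian_on (ngon_space :: 'n tuple_mod set) omega_T xi_T perimeter_T"
  using assms by (simp add: omega_T_proj symplectic_omega_T hamiltonian_xi_T)

end
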